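(* Let $(X,d)$ be an ultrametric space. Then $$\bar{\mathbf{B}}_X^0 = \{\bar{B} \in \bar{\mathbf{B}}_X : \operatorname{diam} \bar{B} > 0\} \cup \bigl\{\{x\} : x \in \operatorname{iso}(X)\bigr\} = \operatorname{iso}(\bar{\mathbf{B}}_X),$$ where $\operatorname{iso}(\bar{\mathbf{B}}_X)$ is the set of isolated points of the metric space $(\bar{\mathbf{B}}_X, d_H)$.
   Context: Metric spaces are nonempty. An ultrametric space is a metric space $(X,d)$ with $d(x,y)\le\max\{d(x,z),d(z,y)\}$ for all $x,y,z\in X$. For $c\in X$ and $r\ge 0$ the closed ball is $\bar B_r(c)=\{x\in X: d(c,x)\le r\}$ (so $\bar B_0(c)=\{c\}$). $\bar{\mathbf{B}}_X$ is the set of all closed balls $\bar B_r(c)$, $c\in X$, $r\ge 0$, regarded as subsets of $X$, and $\bar{\mathbf{B}}_X^0$ is the set of all subsets of $X$ that can be written as $\bar B_r(c)$ with $c\in X$ and $r>0$. The Hausdorff distance between nonempty closed bounded sets $A,B\subseteq X$ is $d_H(A,B)=\max\{\sup_{a\in A}\inf_{b\in B}d(a,b),\ \sup_{b\in B}\inf_{a\in A}d(a,b)\}$; $\bar{\mathbf{B}}_X$ is equipped with the metric $d_H$. The diameter is $\operatorname{diam}A=\sup\{d(x,y):x,y\in A\}$. For a metric space $Y$, $\operatorname{iso}(Y)$ is the set of isolated points of $Y$, i.e. of those $y\in Y$ for which there is $r>0$ such that the closed ball of radius $r$ centered at $y$ equals $\{y\}$. *)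

theory Defs
  imports "HOL-Analysis.Analysis"
begin

text \<open>Metric spaces are given by a carrier and a distance, as in the library locale
  \<^locale>\<open>Metric_space\<close>: the space of balls has sets as points, so the metric type class
  does not apply to it.\<close>

context Metric_space
begin

definition closed_balls :: "'a set set" where
  "closed_balls = {mcball c r | c r. c \<in> M \<and> 0 \<le> r}"

definition pos_closed_balls :: "'a set set" where
  "pos_closed_balls = {mcball c r | c r. c \<in> M \<and> 0 < r}"

definition mdiameter :: "'a set \<Rightarrow> real" where
  "mdiameter A = (if A = {} then 0 else SUP (x, y) \<in> A \<times> A. d x y)"

definition isolated_points :: "'a set" where
  "isolated_points = {y \<in> M. \<exists>r>0. mcball y r = {y}}"

definition closed_bounded_sets :: "'a set set" where
  "closed_bounded_sets = {A. A \<noteq> {} \<and> closedin mtopology A \<and> mbounded A}"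

text \<open>The value 0 for other arguments is a convention: \<^locale>\<open>Metric_space\<close> requires
  nonnegativity and symmetry also outside the carrier.\<close>

definition hausdorff_dist :: "'a set \<Rightarrow> 'a set \<Rightarrow> real" where
  "hausdorff_dist A B =
    (if A \<in> closed_bounded_sets \<and> B \<in> closed_bounded_sets
     then max (SUP a\<in>A. INF b\<in>B. d a b) (SUP b\<in>B. INF a\<in>A. d a b)
     else 0)"

lemma closed_bounded_subset: "A \<in> closed_bounded_sets \<Longrightarrow> A \<subseteq> M"
  using closedin_subset[of mtopology A] by (simp add: closed_bounded_sets_def)

lemma closed_balls_closed_bounded: "closed_balls \<subseteq> closed_bounded_sets"
  by (auto simp: closed_balls_def closed_bounded_sets_def mcball_eq_empty mbounded_def)

lemma bdd_below_dist: "bdd_below ((\<lambda>b. d a b) ` B)" "bdd_below ((\<lambda>b. d b a) ` B)"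
  by (auto intro: bdd_belowI2[where m = 0])

lemma bdd_above_INF_dist:
  assumes "A \<in> closed_bounded_sets" "B \<in> closed_bounded_sets"
  shows "bdd_above ((\<lambda>a. INF b\<in>B. d a b) ` A)"
proof -
  obtain b where b: "b \<in> B" "b \<in> M"
    using assms closed_bounded_subset by (auto simp: closed_bounded_sets_def)
  obtain x k where xk: "A \<subseteq> mcball x k"
    using assms by (auto simp: closed_bounded_sets_def mbounded_def)
  have "(INF b\<in>B. d a b) \<le> k + d x b" if "a \<in> A" for a
  proof -
    have a: "x \<in> M" "a \<in> M" "d x a \<le> k" using xk that by auto
    have "(INF b\<in>B. d a b) \<le> d a b" by (rule cINF_lower[OF bdd_below_dist(1) b(1)])
    also have "\<dots> \<le> d a x + d x b" using a b by (intro triangle)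
    also have "\<dots> \<le> k + d x b" using a by (simp add: commute)
    finally show ?thesis .
  qed
  then show ?thesis by (rule bdd_aboveI2)
qed

lemma SUP_INF_dist_le_iff:
  assumes "A \<in> closed_bounded_sets" "B \<in> closed_bounded_sets"
  shows "(SUP a\<in>A. INF b\<in>B. d a b) \<le> r \<longleftrightarrow> (\<forall>a\<in>A. \<forall>e>r. \<exists>b\<in>B. d a b < e)"
proof -
  have ne: "A \<noteq> {}" "B \<noteq> {}" using assms by (auto simp: closed_bounded_sets_def)
  have "(INF b\<in>B. d a b) \<le> r \<longleftrightarrow> (\<forall>e>r. \<exists>b\<in>B. d a b < e)" for a
    unfolding cINF_less_iff[OF ne(2) bdd_below_dist(1), symmetric]
    by (meson dense_ge le_less_trans less_imp_le)
  then show ?thesis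
    by (simp add: cSUP_le_iff[OF ne(1) bdd_above_INF_dist[OF assms]])
qed

lemma hausdorff_dist_le_iff:
  assumes "A \<in> closed_bounded_sets" "B \<in> closed_bounded_sets"
  shows "hausdorff_dist A B \<le> r \<longleftrightarrow>
    (\<forall>a\<in>A. \<forall>e>r. \<exists>b\<in>B. d a b < e) \<and> (\<forall>b\<in>B. \<forall>e>r. \<exists>a\<in>A. d a b < e)"
  using SUP_INF_dist_le_iff[OF assms] SUP_INF_dist_le_iff[OF assms(2,1)] assms
  by (simp add: hausdorff_dist_def commute)

lemma hausdorff_dist_commute: "hausdorff_dist A B = hausdorff_dist B A"
  by (simp add: hausdorff_dist_def commute max.commute)

lemma hausdorff_dist_nonneg: "0 \<le> hausdorff_dist A B"
proof (cases "A \<in> closed_bounded_sets \<and> B \<in> closed_bounded_sets")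
  case True
  show ?thesis
  proof (rule ccontr)
    assume "\<not> 0 \<le> hausdorff_dist A B"
    moreover obtain a where "a \<in> A" using True by (auto simp: closed_bounded_sets_def)
    ultimately obtain b where "d a b < 0"
      using hausdorff_dist_le_iff[of A B "hausdorff_dist A B"] True
      by (meson linorder_not_less order_refl)
    then show False using nonneg[of a b] by linarith
  qed
qed (auto simp: hausdorff_dist_def)

lemma Metric_space_closed_bounded_sets: "Metric_space closed_bounded_sets hausdorff_dist"
proof
  fix A B assume AB: "A \<in> closed_bounded_sets" "B \<in> closed_bounded_sets"
  have sub: "A \<subseteq> B" if "A \<in> closed_bounded_sets" "B \<in> closed_bounded_sets"
    "hausdorff_dist A B = 0" for A B
  proof -
    have near: "\<forall>a\<in>A. \<forall>e>0. \<exists>b\<in>B. d a b < e"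
      using that hausdorff_dist_le_iff[of A B 0] by simp
    have "A \<subseteq> mtopology closure_of B"
      using near closed_bounded_subset[OF that(1)] closed_bounded_subset[OF that(2)]
      by (fastforce simp: metric_closure_of)
    then show ?thesis
      using that(2) by (simp add: closed_bounded_sets_def closure_of_closedin)
  qed
  have "hausdorff_dist A A \<le> 0"
    unfolding hausdorff_dist_le_iff[OF AB(1) AB(1)]
    using closed_bounded_subset[OF AB(1)] by (metis mdist_zero subsetD)
  then show "hausdorff_dist A B = 0 \<longleftrightarrow> A = B"
    using sub[OF AB] sub[OF AB(2,1)] hausdorff_dist_nonneg[of A A]
    by (auto simp: hausdorff_dist_commute)
next
  fix A B C
  assume ABC: "A \<in> closed_bounded_sets" "B \<in> closed_bounded_sets" "C \<in> closed_bounded_sets"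
  have le: "\<exists>c\<in>C. d a c < e"
    if ABC: "A \<in> closed_bounded_sets" "B \<in> closed_bounded_sets" "C \<in> closed_bounded_sets"
      and e: "hausdorff_dist A B + hausdorff_dist B C < e" and a: "a \<in> A" for A B C a e
  proof -
    define t where "t = (e - hausdorff_dist A B - hausdorff_dist B C) / 2"
    have t: "t > 0" using e by (simp add: t_def)
    obtain b where b: "b \<in> B" "d a b < hausdorff_dist A B + t"
      using hausdorff_dist_le_iff[OF ABC(1,2), of "hausdorff_dist A B"] a t
      by (meson less_add_same_cancel1 order_refl)
    obtain c where c: "c \<in> C" "d b c < hausdorff_dist B C + t"
      using hausdorff_dist_le_iff[OF ABC(2,3), of "hausdorff_dist B C"] b t
      by (meson less_add_same_cancel1 order_refl)
    have "d a c \<le> d a b + d b c"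
      using a b c ABC closed_bounded_subset by (intro triangle) auto
    moreover have "hausdorff_dist A B + t + (hausdorff_dist B C + t) = e"
      by (simp add: t_def field_simps)
    ultimately show ?thesis using b c by (intro bexI[OF _ c(1)]) linarith
  qed
  show "hausdorff_dist A C \<le> hausdorff_dist A B + hausdorff_dist B C"
    unfolding hausdorff_dist_le_iff[OF ABC(1,3)]
    using le[OF ABC] le[OF ABC(3,2,1)]
    by (simp add: hausdorff_dist_commute commute add.commute)
qed (simp_all add: hausdorff_dist_nonneg hausdorff_dist_commute)

corollary Metric_space_closed_balls: "Metric_space closed_balls hausdorff_dist"
  using Metric_space.subspace[OF Metric_space_closed_bounded_sets closed_balls_closed_bounded] .

end

locale Ultrametric_space = Metric_space +
  assumes nonempty: "M \<noteq> {}"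
    and ultrametric: "\<lbrakk>x \<in> M; y \<in> M; z \<in> M\<rbrakk> \<Longrightarrow> d x y \<le> max (d x z) (d z y)"

end

theory Submission
  imports Defs
begin

text \<open>If a ball \<open>B\<close> contains \<open>x \<noteq> y\<close>, then every ball at Hausdorff distance less than
  \<open>d x y\<close> from \<open>B\<close> equals \<open>B\<close>: it lies in \<open>B\<close> because \<open>d x y\<close> is at most the radius of \<open>B\<close>,
  and if it missed a point of \<open>B\<close>, its radius would be less than \<open>d x y\<close>, so all of \<open>B\<close>
  would lie at distance less than \<open>d x y\<close> from its centre. A singleton ball \<open>{x}\<close> is isolated
  if and only if \<open>x\<close> is, since \<open>x \<mapsto> {x}\<close> is an isometry and a ball near \<open>{x}\<close> consists of
  points near \<open>x\<close>.\<close>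

context Metric_space
begin

text \<open>Boundedness makes the supremum of the distances genuine, so it exceeds 0 exactly when
  one of the distances does.\<close>

lemma mdiameter_pos_iff:
  assumes "A \<subseteq> M" "mbounded A"
  shows "0 < mdiameter A \<longleftrightarrow> (\<exists>x\<in>A. \<exists>y\<in>A. x \<noteq> y)"
proof (cases "A = {}")
  case True
  then show ?thesis by (simp add: mdiameter_def)
next
  case False
  obtain k where "\<forall>x\<in>A. \<forall>y\<in>A. d x y \<le> k"
    using assms(2) by (auto simp: mbounded_alt)
  then have bdd: "bdd_above ((\<lambda>(x, y). d x y) ` (A \<times> A))"
    by (auto intro!: bdd_aboveI[where M = k])
  have "0 < mdiameter A \<longleftrightarrow> (\<exists>p\<in>A \<times> A. 0 < (case p of (x, y) \<Rightarrow> d x y))"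
    using False less_cSUP_iff[OF _ bdd, of 0] by (simp add: mdiameter_def)
  also have "\<dots> \<longleftrightarrow> (\<exists>x\<in>A. \<exists>y\<in>A. x \<noteq> y)"
    using assms(1) by (auto simp: subset_iff)
  finally show ?thesis .
qed

lemma closed_balls_mdiameter_pos_iff:
  "B \<in> closed_balls \<Longrightarrow> 0 < mdiameter B \<longleftrightarrow> (\<exists>x\<in>B. \<exists>y\<in>B. x \<noteq> y)"
  using closed_balls_closed_bounded closed_bounded_subset
  by (intro mdiameter_pos_iff) (auto simp: closed_bounded_sets_def)

lemma mcball_zero: "x \<in> M \<Longrightarrow> mcball x 0 = {x}"
proof (intro equalityI subsetI)
  fix y assume "x \<in> M" "y \<in> mcball x 0"
  then have "y \<in> M" "d x y = 0" using nonneg[of x y] by auto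
  with \<open>x \<in> M\<close> show "y \<in> {x}" by simp
qed simp

lemma singleton_closed_ball: "x \<in> M \<Longrightarrow> {x} \<in> closed_balls"
  unfolding closed_balls_def using mcball_zero[of x] by (auto intro!: exI[of _ x] exI[of _ 0])

text \<open>A ball contains its centre, so if it has no two distinct points only the centre is left.
  The split is by point set and not by radius: a ball of positive radius may be a singleton.\<close>

lemma closed_ball_cases:
  assumes "B \<in> closed_balls"
  obtains "0 < mdiameter B" | x where "x \<in> M" "B = {x}"
proof -
  from assms obtain c r where "c \<in> M" "B = mcball c r" "c \<in> B"
    by (auto simp: closed_balls_def)
  then show thesis
    using that(1) that(2)[of c] closed_balls_mdiameter_pos_iff[OF assms] by auto
qed

lemma pos_closed_balls_eq:
  "pos_closed_balls = {B \<in> closed_balls. 0 < mdiameter B} \<union> {{x} | x. x \<in> isolated_points}"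
proof (intro equalityI subsetI)
  fix B assume "B \<in> pos_closed_balls"
  then obtain c r where cr: "c \<in> M" "0 < r" "B = mcball c r"
    by (auto simp: pos_closed_balls_def)
  then have B: "B \<in> closed_balls" "c \<in> B"
    by (auto simp: closed_balls_def intro!: exI[of _ c] exI[of _ r])
  from B(1) show "B \<in> {B \<in> closed_balls. 0 < mdiameter B} \<union> {{x} | x. x \<in> isolated_points}"
  proof (cases rule: closed_ball_cases)
    case (2 x)
    \<comment> \<open>The centre \<open>c\<close> lies in \<open>{x}\<close>, so
      \<open>x = c\<close> and the given positive radius \<open>r\<close> itself witnesses
      isolation.\<close>
    then have "c \<in> isolated_points" "B = {c}"
      using B cr by (auto simp: isolated_points_def)
    then show ?thesis by blast
  qed (use B in blast)
next
  fix B assume "B \<in> {B \<in> closed_balls. 0 < mdiameter B} \<union> {{x} | x. x \<in> isolated_points}"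
  then consider "B \<in> closed_balls" "0 < mdiameter B" | x where "x \<in> isolated_points" "B = {x}"
    by blast
  then show "B \<in> pos_closed_balls"
  proof cases
    case 1
    then obtain c r x y where cr: "c \<in> M" "0 \<le> r" "B = mcball c r" "x \<in> B" "y \<in> B" "x \<noteq> y"
      using closed_balls_mdiameter_pos_iff by (auto simp: closed_balls_def)
    then have "r \<noteq> 0" using mcball_zero by (metis singletonD)
    with cr have "0 < r" by simp
    with cr show ?thesis unfolding pos_closed_balls_def by blast
  next
    case 2
    then obtain r where "r > 0" "mcball x r = B" "x \<in> M"
      by (auto simp: isolated_points_def)
    then show ?thesis by (auto simp: pos_closed_balls_def)
  qed
qed

lemma isolated_closed_ball_iff:
  "B \<in> Metric_space.isolated_points closed_balls hausdorff_dist \<longleftrightarrow>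
    B \<in> closed_balls \<and> (\<exists>r>0. \<forall>C\<in>closed_balls. hausdorff_dist B C \<le> r \<longrightarrow> C = B)"
proof -
  interpret H: Metric_space closed_balls hausdorff_dist
    by (rule Metric_space_closed_balls)
  have "H.mcball B r = {B} \<longleftrightarrow> (\<forall>C\<in>closed_balls. hausdorff_dist B C \<le> r \<longrightarrow> C = B)"
    if "B \<in> closed_balls" "r > 0" for r
    using that by auto
  then show ?thesis by (auto simp: H.isolated_points_def)
qed

lemma hausdorff_dist_lessD:
  assumes "A \<in> closed_balls" "B \<in> closed_balls" "hausdorff_dist A B < e"
  shows "a \<in> A \<Longrightarrow> \<exists>b\<in>B. d a b < e" "b \<in> B \<Longrightarrow> \<exists>a\<in>A. d a b < e"
proof -
  have "A \<in> closed_bounded_sets" "B \<in> closed_bounded_sets"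
    using assms closed_balls_closed_bounded by auto
  \<comment> \<open>With the distance itself as the bound, the left side of the equivalence is
    trivial and \<open>e\<close> is one of the admissible values above it.\<close>
  from hausdorff_dist_le_iff[OF this, of "hausdorff_dist A B"] assms(3)
  show "a \<in> A \<Longrightarrow> \<exists>b\<in>B. d a b < e" "b \<in> B \<Longrightarrow> \<exists>a\<in>A. d a b < e"
    by auto
qed

lemma hausdorff_dist_singletons:
  assumes "x \<in> M" "y \<in> M"
  shows "hausdorff_dist {x} {y} = d x y"
proof -
  have "{x} \<in> closed_bounded_sets" "{y} \<in> closed_bounded_sets"
    using assms singleton_closed_ball closed_balls_closed_bounded by auto
  then show ?thesis by (simp add: hausdorff_dist_def)
qed

lemma isolated_singleton_iff:
  "{x} \<in> Metric_space.isolated_points closed_balls hausdorff_dist \<longleftrightarrow> x \<in> isolated_points"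
proof
  assume iso: "{x} \<in> Metric_space.isolated_points closed_balls hausdorff_dist"
  then have x: "x \<in> M"
    unfolding isolated_closed_ball_iff by (auto simp: closed_balls_def)
  obtain r where r: "r > 0" "\<And>C. C \<in> closed_balls \<Longrightarrow> hausdorff_dist {x} C \<le> r \<Longrightarrow> C = {x}"
    using iso by (auto simp: isolated_closed_ball_iff)
  \<comment> \<open>Testing isolation only on singleton balls \<open>{y}\<close>, whose distance
    from \<open>{x}\<close> is \<open>d x y\<close>, carries the radius \<open>r\<close> over to
    points.\<close>
  have "y = x" if "y \<in> mcball x r" for y
    using that r(2)[of "{y}"] x by (auto simp: singleton_closed_ball hausdorff_dist_singletons)
  then have "mcball x r = {x}" using x r by auto
  with x r show "x \<in> isolated_points" by (auto simp: isolated_points_def)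
next
  assume "x \<in> isolated_points"
  then obtain r where r: "r > 0" "mcball x r = {x}" and x: "x \<in> M"
    by (auto simp: isolated_points_def)
  \<comment> \<open>Isolation is stated with a non-strict bound; halving \<open>r\<close> gives the
    strict one that yields actual nearby points.\<close>
  have "C = {x}" if C: "C \<in> closed_balls" "hausdorff_dist {x} C \<le> r / 2" for C
  proof -
    have lt: "hausdorff_dist {x} C < r" using C r by simp
    have "c = x" if "c \<in> C" for c
    proof -
      have "d x c < r"
        using hausdorff_dist_lessD(2)[OF singleton_closed_ball[OF x] C(1) lt that] by simp
      moreover have "c \<in> M" using that C(1) by (auto simp: closed_balls_def)
      ultimately have "c \<in> mcball x r" using x by simp
      then show ?thesis using r by simp
    qed
    moreover have "C \<noteq> {}" using C(1) by (auto simp: closed_balls_def)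
    ultimately show ?thesis by blast
  qed
  then show "{x} \<in> Metric_space.isolated_points closed_balls hausdorff_dist"
    using r(1) singleton_closed_ball[OF x] half_gt_zero unfolding isolated_closed_ball_iff by blast
qed

end

context Ultrametric_space
begin

lemma ultrametric_less:
  "\<lbrakk>d x z < e; d z y < e; x \<in> M; y \<in> M; z \<in> M\<rbrakk> \<Longrightarrow> d x y < e"
  by (meson le_less_trans max_less_iff_conj ultrametric)

lemma closed_ball_eq_if_hausdorff_dist_less:
  assumes B: "B \<in> closed_balls" and C: "C \<in> closed_balls" and xy: "x \<in> B" "y \<in> B"
    and lt: "hausdorff_dist B C < d x y"
  shows "C = B"
proof
  obtain a r where a: "a \<in> M" "B = mcball a r" using B by (auto simp: closed_balls_def)
  obtain c t where c: "c \<in> M" "C = mcball c t" using C by (auto simp: closed_balls_def)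
  have near: "\<exists>q\<in>C. d p q < d x y" if "p \<in> B" for p
    using hausdorff_dist_lessD(1)[OF B C lt that] .
  \<comment> \<open>Both points are within \<open>r\<close> of the centre \<open>a\<close>, and the
    strong triangle inequality through \<open>a\<close> does not double the bound.\<close>
  have xyr: "d x y \<le> r"
    using ultrametric[of x y a] xy a by (auto simp: commute)
  show "C \<subseteq> B"
  proof
    fix q assume q: "q \<in> C"
    obtain p where "p \<in> B" "d p q < d x y"
      using hausdorff_dist_lessD(2)[OF B C lt q] by blast
    then show "q \<in> B"
      using ultrametric[of a q p] xyr q a c by auto
  qed
  show "B \<subseteq> C"
  proof (rule ccontr)
    assume "\<not> B \<subseteq> C"
    then obtain b where b: "b \<in> B" "b \<notin> C" by blast
    obtain q where q: "q \<in> C" "d b q < d x y" using near b by blast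
    \<comment> \<open>As \<open>b\<close> is outside \<open>C\<close>, \<open>t < d c b\<close>.
      Since \<open>d c q \<le> t\<close>, the maximum of \<open>d c q\<close> and
      \<open>d q b\<close> bounding \<open>d c b\<close> must be \<open>d q b\<close>, which is less
      than \<open>d x y\<close>.\<close>
    have t: "t < d x y"
      using ultrametric[of c b q] a b c q by (auto simp: commute)
    \<comment> \<open>Go from \<open>p\<close> to a nearby \<open>q\<close> in \<open>C\<close>,
      then to the centre \<open>c\<close>: the second leg is at most \<open>t\<close>, so both are
      below \<open>d x y\<close>.\<close>
    have to_c: "d p c < d x y" if p: "p \<in> B" for p
    proof -
      obtain q where q: "q \<in> C" "d p q < d x y" using near p by blast
      then have "d q c < d x y" using c t by (auto simp: commute)
      then show ?thesis
        using ultrametric_less[of p q _ c] q p a c by auto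
    qed
    \<comment> \<open>Applied to \<open>x\<close> and \<open>y\<close> themselves, this makes the
      path through \<open>c\<close> too short.\<close>
    have "d x y < d x y"
      using ultrametric_less[of x c "d x y" y] to_c[OF xy(1)] to_c[OF xy(2)] xy a c
      by (auto simp: commute)
    then show False by simp
  qed
qed

lemma isolated_if_mdiameter_pos:
  assumes "B \<in> closed_balls" "0 < mdiameter B"
  shows "B \<in> Metric_space.isolated_points closed_balls hausdorff_dist"
proof -
  obtain x y where xy: "x \<in> B" "y \<in> B" "x \<noteq> y"
    using assms closed_balls_mdiameter_pos_iff by blast
  then have "x \<in> M" "y \<in> M" using assms(1) by (auto simp: closed_balls_def)
  with xy have pos: "0 < d x y" by simp
  \<comment> \<open>Half of \<open>d x y\<close> serves as the isolating radius, because the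
    preceding rigidity needs a strict inequality.\<close>
  have "C = B" if "C \<in> closed_balls" "hausdorff_dist B C \<le> d x y / 2" for C
    using closed_ball_eq_if_hausdorff_dist_less[OF assms(1) that(1) xy(1,2)] that(2) pos by simp
  then show ?thesis
    using assms(1) pos half_gt_zero unfolding isolated_closed_ball_iff by blast
qed

lemma isolated_closed_balls_eq:
  "{B \<in> closed_balls. 0 < mdiameter B} \<union> {{x} | x. x \<in> isolated_points} =
    Metric_space.isolated_points closed_balls hausdorff_dist"
proof (intro equalityI subsetI)
  fix B assume B: "B \<in> Metric_space.isolated_points closed_balls hausdorff_dist"
  then have "B \<in> closed_balls" by (simp add: isolated_closed_ball_iff)
  then show "B \<in> {B \<in> closed_balls. 0 < mdiameter B} \<union> {{x} | x. x \<in> isolated_points}"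
  proof (cases rule: closed_ball_cases)
    case 1
    with \<open>B \<in> closed_balls\<close> show ?thesis by simp
  next
    case (2 x)
    with B show ?thesis by (simp add: isolated_singleton_iff)
  qed
next
  fix B assume "B \<in> {B \<in> closed_balls. 0 < mdiameter B} \<union> {{x} | x. x \<in> isolated_points}"
  then consider "B \<in> closed_balls" "0 < mdiameter B" | x where "x \<in> isolated_points" "B = {x}"
    by blast
  then show "B \<in> Metric_space.isolated_points closed_balls hausdorff_dist"
    by cases (simp_all add: isolated_if_mdiameter_pos isolated_singleton_iff)
qed

end

theorem theorem4p12:
  fixes M :: "'a set" and d :: "'a \<Rightarrow> 'a \<Rightarrow> real"
  assumes "Ultrametric_space M d"
  shows "Metric_space.pos_closed_balls M d =
      {B \<in> Metric_space.closed_balls M d. Metric_space.mdiameter d B > 0} \<union>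
      {{x} | x. x \<in> Metric_space.isolated_points M d} \<and>
    {B \<in> Metric_space.closed_balls M d. Metric_space.mdiameter d B > 0} \<union>
      {{x} | x. x \<in> Metric_space.isolated_points M d} =
    Metric_space.isolated_points
      (Metric_space.closed_balls M d) (Metric_space.hausdorff_dist M d)"
proof -
  interpret Ultrametric_space M d by (rule assms)
  show ?thesis
    by (rule conjI[OF pos_closed_balls_eq isolated_closed_balls_eq])
qed

end
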